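(* Let $k\ge 0$, and let $(f_h,\mathbf E_h,\mathbf B_h)$, with $f_h(t)\in\mathcal G_h^k$, be a solution of the semi-discrete discontinuous Galerkin scheme for the Vlasov–Maxwell system described in the context (upwind flux for the Vlasov part; any of the listed fluxes for the Maxwell part). Then $$\frac{d}{dt}\int_{\mathcal T_h} f_h\, d\mathbf x\, d\xi+\Theta_{h,1}(t)=0,\qquad \Theta_{h,1}(t)=\int_{\mathcal T_h^x}\int_{\mathcal E_\xi^b} f_h\,\max\big((\mathbf E_h+\xi\times\mathbf B_h)\cdot\mathbf n_\xi,\,0\big)\,ds_\xi\, d\mathbf x .$$ Equivalently, with $\rho_h(\mathbf x,t)=\int_{\mathcal T_h^\xi} f_h(\mathbf x,\xi,t)\,d\xi$, for any $T>0$, $$\int_{\mathcal T_h^x}\rho_h(\mathbf x,T)\,d\mathbf x+\int_0^T\Theta_{h,1}(t)\,dt=\int_{\mathcal T_h^x}\rho_h(\mathbf x,0)\,d\mathbf x .$$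
   Context: Domain and mesh. $d_x=d_\xi=3$, $\Omega_x=(-L_x,L_x]^{3}$ with periodic boundary conditions in $\mathbf x$, $\Omega_\xi=[-L_\xi,L_\xi]^{3}$, $\Omega=\Omega_x\times\Omega_\xi$. $\mathcal T_h^x=\{K_x\}$ and $\mathcal T_h^\xi=\{K_\xi\}$ are partitions of $\Omega_x$ and $\Omega_\xi$ into (rotated) Cartesian elements or simplices, and $\mathcal T_h=\{K_x\times K_\xi\}$ is the product partition of $\Omega$. $\mathcal E_x$, $\mathcal E_\xi$ are the sets of edges (faces) of $\mathcal T_h^x$, $\mathcal T_h^\xi$; periodicity is taken into account in $\mathcal E_x$ (so every edge of $\mathcal E_x$ is shared by two elements), and $\mathcal E_\xi=\mathcal E_\xi^i\cup\mathcal E_\xi^b$ with $\mathcal E_\xi^i$ interior and $\mathcal E_\xi^b$ boundary edges. Integrals over $\mathcal T_h,\mathcal T_h^x,\mathcal T_h^\xi,\mathcal E_x,\mathcal E_\xi,\mathcal E_\xi^b$ are sums of integrals over the elements/edges in the set. $\mathbf n_x$, $\mathbf n_\xi$ are unit normals (outward on element boundaries and on $\mathcal E_\xi^b$). Discrete spaces ($P^m(D)$: polynomials of total degree at most $m$ on $D$). $\mathcal G_h^k=\{g\in L^2(\Omega): g|_K\in P^k(K)\ \forall K\in\mathcal T_h\}$, $\mathcal U_h^r=\{\mathbf U\in[L^2(\Omega_x)]^3: \mathbf U|_{K_x}\in[P^r(K_x)]^3\ \forall K_x\in\mathcal T_h^x\}$, with integers $k,r\ge0$. Jumps and averages. For an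 edge $e=K_x^+\cap K_x^-\in\mathcal E_x$ with outward unit normals $\mathbf n_x^\pm$ to $\partial K_x^\pm$, and traces $g^\pm,\mathbf U^\pm$ from $K_x^\pm$: $[g]_x=g^+\mathbf n_x^++g^-\mathbf n_x^-$, $[\mathbf U]_x=\mathbf U^+\cdot\mathbf n_x^++\mathbf U^-\cdot\mathbf n_x^-$, $[\mathbf U]_\tau=\mathbf U^+\times\mathbf n_x^++\mathbf U^-\times\mathbf n_x^-$, $\{g\}_x=\frac12(g^++g^-)$, $\{\mathbf U\}_x=\frac12(\mathbf U^++\mathbf U^-)$. The quantities $[\cdot]_\xi,\{\cdot\}_\xi$ on $\mathcal E_\xi^i$ are defined analogously; on $\mathcal E_\xi^b$ with outward unit normal $\mathbf n_\xi$: $[g]_\xi=g\,\mathbf n_\xi$, $\{g\}_\xi=\frac12 g$, $\{\mathbf U\}_\xi=\frac12\mathbf U$. Scheme. Find time-dependent $f_h\in\mathcal G_h^k$, $\mathbf E_h,\mathbf B_h\in\mathcal U_h^r$ such that for all $g\in\mathcal G_h^k$, $\mathbf U,\mathbf V\in\mathcal U_h^r$: $a_h(f_h,\mathbf E_h,\mathbf B_h;g)=0$ and $b_h(\mathbf E_h,\mathbf B_h;\mathbf U,\mathbf V)=l_h(\mathbf J_h;\mathbf U)$, where $\mathbf J_h(\mathbf x,t)=\int_{\mathcal T_h^\xi} f_h\,\xi\,d\xi$, $l_h(\mathbf J_h;\mathbf U)=-\int_{\mathcal T_h^x}\mathbf J_h\cdot\mathbf U\,d\mathbf x$, $$a_h=\int_{\mathcal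 T_h}\partial_tf_h\,g\,d\mathbf xd\xi-\int_{\mathcal T_h}f_h\,\xi\cdot\nabla_{\mathbf x}g\,d\mathbf xd\xi+\int_{\mathcal T_h^\xi}\int_{\mathcal E_x}\widetilde{f_h\xi}\cdot[g]_x\,ds_xd\xi-\int_{\mathcal T_h}f_h(\mathbf E_h+\xi\times\mathbf B_h)\cdot\nabla_\xi g\,d\mathbf xd\xi+\int_{\mathcal T_h^x}\int_{\mathcal E_\xi}\widetilde{f_h(\mathbf E_h+\xi\times\mathbf B_h)}\cdot[g]_\xi\,ds_\xi d\mathbf x,$$ $$b_h=\int_{\mathcal T_h^x}\partial_t\mathbf E_h\cdot\mathbf U\,d\mathbf x-\int_{\mathcal T_h^x}\mathbf B_h\cdot\nabla\times\mathbf U\,d\mathbf x-\int_{\mathcal E_x}\widetilde{\mathbf B_h}\cdot[\mathbf U]_\tau ds_x+\int_{\mathcal T_h^x}\partial_t\mathbf B_h\cdot\mathbf V\,d\mathbf x+\int_{\mathcal T_h^x}\mathbf E_h\cdot\nabla\times\mathbf V\,d\mathbf x+\int_{\mathcal E_x}\widetilde{\mathbf E_h}\cdot[\mathbf V]_\tau ds_x.$$ Upwind flux for the Vlasov part: $\widetilde{f_h\xi}=\{f_h\xi\}_x+\frac{|\xi\cdot\mathbf n_x|}{2}[f_h]_x$, $\ \widetilde{f_h(\mathbf E_h+\xi\times\mathbf B_h)}=\{f_h(\mathbf E_h+\xi\times\mathbf B_h)\}_\xi+\frac{|(\mathbf E_h+\xi\times\mathbf B_h)\cdot\mathbf n_\xi|}{2}[f_h]_\xi$.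 Flux for the Maxwell part: upwind $\widetilde{\mathbf E_h}=\{\mathbf E_h\}_x+\frac12[\mathbf B_h]_\tau$, $\widetilde{\mathbf B_h}=\{\mathbf B_h\}_x-\frac12[\mathbf E_h]_\tau$; or central $\widetilde{\mathbf E_h}=\{\mathbf E_h\}_x$, $\widetilde{\mathbf B_h}=\{\mathbf B_h\}_x$; or alternating $\widetilde{\mathbf E_h}=\mathbf E_h^+$, $\widetilde{\mathbf B_h}=\mathbf B_h^-$ (or $\widetilde{\mathbf E_h}=\mathbf E_h^-$, $\widetilde{\mathbf B_h}=\mathbf B_h^+$). *)

theory Defs
  imports "HOL-Analysis.Analysis"
begin

unbundle no cross3_syntax
unbundle set_product_syntax

definition cartesian_element :: "(real^3) set \<Rightarrow> bool" where
  "cartesian_element K \<longleftrightarrow>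
     (\<exists>(R :: real^3 \<Rightarrow> real^3) a b. orthogonal_transformation R \<and> box a b \<noteq> {} \<and> K = R ` cbox a b)"

text \<open>Elements are closed sets overlapping only in their boundaries; accordingly
  they cover the closure of the domain, which makes the half-open periodic cell
  and its closure interchangeable here.\<close>

definition mesh_of :: "(real^3) set set \<Rightarrow> (real^3) set \<Rightarrow> bool" where
  "mesh_of T D \<longleftrightarrow>
     finite T \<and> (\<forall>K\<in>T. cartesian_element K \<or> 3 simplex K) \<and> \<Union>T = closure D \<and>
     (\<forall>K\<in>T. \<forall>K'\<in>T. K \<noteq> K' \<longrightarrow> interior K \<inter> interior K' = {})"

text \<open>\<open>Face K\<^sup>+ K\<^sup>- s\<close> stands for the common face of \<open>K\<^sup>+\<close> and of \<open>K\<^sup>-\<close> translated by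
  the period \<open>s\<close> (\<open>s = 0\<close> for an ordinary interior face).  A point \<open>y\<close> of the face
  corresponds to the point \<open>y - s\<close> of \<open>K\<^sup>-\<close> itself.\<close>

datatype face = Face (pos: "(real^3) set") (neg: "(real^3) set") (shift: "real^3")

definition neg_image :: "face \<Rightarrow> (real^3) set" where
  "neg_image e = (\<lambda>y. y + shift e) ` neg e"

definition face_set :: "face \<Rightarrow> (real^3) set" where
  "face_set e = pos e \<inter> neg_image e"

definition adjacent :: "(real^3) set \<Rightarrow> (real^3) set set \<Rightarrow> face set" where
  "adjacent \<Lambda> T = {e. pos e \<in> T \<and> neg e \<in> T \<and> shift e \<in> \<Lambda> \<and>
     (pos e \<noteq> neg e \<or> shift e \<noteq> 0) \<and> aff_dim (face_set e) = 2}"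

definition flip :: "face \<Rightarrow> face" where
  "flip e = Face (neg e) (pos e) (- shift e)"

text \<open>Every geometric face occurs in \<open>adjacent\<close> once for each labelling of its sides by
  \<open>+\<close> and \<open>-\<close>; a set of faces contains exactly one of the two, chosen arbitrarily.
  The choice matters only for the alternating fluxes.\<close>

definition face_choice :: "(real^3) set \<Rightarrow> (real^3) set set \<Rightarrow> face set \<Rightarrow> bool" where
  "face_choice \<Lambda> T \<E> \<longleftrightarrow>
     \<E> \<subseteq> adjacent \<Lambda> T \<and> (\<forall>e \<in> adjacent \<Lambda> T. (e \<in> \<E>) \<noteq> (flip e \<in> \<E>))"

record dg_mesh =
  Lx :: real
  Lxi :: real
  Tx :: "(real^3) set set"
  Txi :: "(real^3) set set"
  Ex :: "face set"
  Exi :: "face set" \<comment> \<open>interior faces only; the boundary faces are \<open>Exi_bd\<close>\<close>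

definition Omega_x :: "dg_mesh \<Rightarrow> (real^3) set" where
  "Omega_x M = {x. \<forall>i. - Lx M < x $ i \<and> x $ i \<le> Lx M}"

definition Omega_xi :: "dg_mesh \<Rightarrow> (real^3) set" where
  "Omega_xi M = {\<xi>. \<forall>i. - Lxi M \<le> \<xi> $ i \<and> \<xi> $ i \<le> Lxi M}"

definition periods :: "dg_mesh \<Rightarrow> (real^3) set" where
  "periods M = {s. \<forall>i. \<exists>m::int. s $ i = 2 * Lx M * of_int m}"

definition wf_mesh :: "dg_mesh \<Rightarrow> bool" where
  "wf_mesh M \<longleftrightarrow> Lx M > 0 \<and> Lxi M > 0 \<and>
     mesh_of (Tx M) (Omega_x M) \<and> mesh_of (Txi M) (Omega_xi M) \<and>
     face_choice (periods M) (Tx M) (Ex M) \<and> face_choice {0} (Txi M) (Exi M)"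

definition Th :: "dg_mesh \<Rightarrow> ((real^3) \<times> (real^3)) set set" where
  "Th M = {Kx \<times> Kxi | Kx Kxi. Kx \<in> Tx M \<and> Kxi \<in> Txi M}"

definition Exi_bd :: "dg_mesh \<Rightarrow> ((real^3) set \<times> (real^3) set) set" where
  "Exi_bd M = {(K, F). K \<in> Txi M \<and> F facet_of K \<and> F \<subseteq> frontier (Omega_xi M)}"

definition outward_normal :: "(real^3) set \<Rightarrow> (real^3) set \<Rightarrow> real^3" where
  "outward_normal K F = (THE n. norm n = 1 \<and> (\<forall>x\<in>F. \<forall>y\<in>K. n \<bullet> y \<le> n \<bullet> x))"

definition normal_pos :: "face \<Rightarrow> real^3" where
  "normal_pos e = outward_normal (pos e) (face_set e)"

definition normal_neg :: "face \<Rightarrow> real^3" where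
  "normal_neg e = outward_normal (neg_image e) (face_set e)"

definition mesh_integral ::
    "'a::euclidean_space set set \<Rightarrow> ('a \<Rightarrow> 'b::{banach,second_countable_topology}) \<Rightarrow> 'b" where
  "mesh_integral T h = (\<Sum>K\<in>T. LINT z:K|lebesgue. h z)"

text \<open>Surface measure on the plane spanned by a flat two-dimensional set: the image of
  two-dimensional Lebesgue measure under an isometric parametrisation of that plane.
  It does not depend on the parametrisation, as any two differ by an isometry of
  the parameter plane.\<close>

definition plane_measure :: "(real^3) set \<Rightarrow> (real^3) measure" where
  "plane_measure F = distr lborel borel
     (SOME \<phi> :: real^2 \<Rightarrow> real^3.
        (\<forall>u v. dist (\<phi> u) (\<phi> v) = dist u v) \<and> range \<phi> = affine hull F)"

definition face_integral :: "(real^3) set \<Rightarrow> (real^3 \<Rightarrow> real) \<Rightarrow> real" where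
  "face_integral F h = (LINT y:F|plane_measure F. h y)"

definition poly_space :: "nat \<Rightarrow> ('a::euclidean_space \<Rightarrow> real) set" where
  "poly_space m = {p. \<exists>c. \<forall>z. p z =
     (\<Sum>\<alpha> | \<alpha> \<in> Basis \<rightarrow>\<^sub>E {..m} \<and> sum \<alpha> Basis \<le> m. c \<alpha> * (\<Prod>b\<in>Basis. (z \<bullet> b) ^ \<alpha> b))}"

definition square_integrable ::
    "'a::euclidean_space set \<Rightarrow> ('a \<Rightarrow> 'b::euclidean_space) \<Rightarrow> bool" where
  "square_integrable D g \<longleftrightarrow>
     set_borel_measurable lebesgue D g \<and> set_integrable lebesgue D (\<lambda>z. (norm (g z))\<^sup>2)"

text \<open>A member of a discrete space is prescribed on the open elements only, its values
  on the skeleton of the mesh being immaterial, as for \<open>L\<^sup>2\<close> functions.  On faces one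
  uses the one-sided traces defined below, never these values.\<close>

definition Gh :: "dg_mesh \<Rightarrow> nat \<Rightarrow> ((real^3) \<times> (real^3) \<Rightarrow> real) set" where
  "Gh M k = {g. square_integrable (Omega_x M \<times> Omega_xi M) g \<and>
     (\<forall>K\<in>Th M. \<exists>p\<in>poly_space k. \<forall>z\<in>interior K. g z = p z)}"

definition Uh :: "dg_mesh \<Rightarrow> nat \<Rightarrow> (real^3 \<Rightarrow> real^3) set" where
  "Uh M r = {U. square_integrable (Omega_x M) U \<and>
     (\<forall>K\<in>Tx M. \<forall>i. \<exists>p\<in>poly_space r. \<forall>x\<in>interior K. U x $ i = p x)}"

definition elem_trace :: "(real^3) set \<Rightarrow> (real^3 \<Rightarrow> 'b::t2_space) \<Rightarrow> real^3 \<Rightarrow> 'b" where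
  "elem_trace K u y = Lim (at y within interior K) u"

definition trace_pos :: "face \<Rightarrow> (real^3 \<Rightarrow> 'b::t2_space) \<Rightarrow> real^3 \<Rightarrow> 'b" where
  "trace_pos e u y = elem_trace (pos e) u y"

definition trace_neg :: "face \<Rightarrow> (real^3 \<Rightarrow> 'b::t2_space) \<Rightarrow> real^3 \<Rightarrow> 'b" where
  "trace_neg e u y = elem_trace (neg e) u (y - shift e)"

definition avg :: "face \<Rightarrow> (real^3 \<Rightarrow> 'b::real_normed_vector) \<Rightarrow> real^3 \<Rightarrow> 'b" where
  "avg e u y = (1/2) *\<^sub>R (trace_pos e u y + trace_neg e u y)"

definition jump :: "face \<Rightarrow> (real^3 \<Rightarrow> real) \<Rightarrow> real^3 \<Rightarrow> real^3" where
  "jump e u y = trace_pos e u y *\<^sub>R normal_pos e + trace_neg e u y *\<^sub>R normal_neg e"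

definition jump_tan :: "face \<Rightarrow> (real^3 \<Rightarrow> real^3) \<Rightarrow> real^3 \<Rightarrow> real^3" where
  "jump_tan e U y =
     cross3 (trace_pos e U y) (normal_pos e) + cross3 (trace_neg e U y) (normal_neg e)"

definition avg_bd :: "(real^3) set \<Rightarrow> (real^3 \<Rightarrow> 'b::real_normed_vector) \<Rightarrow> real^3 \<Rightarrow> 'b" where
  "avg_bd K u y = (1/2) *\<^sub>R elem_trace K u y"

definition jump_bd ::
    "(real^3) set \<Rightarrow> (real^3) set \<Rightarrow> (real^3 \<Rightarrow> real) \<Rightarrow> real^3 \<Rightarrow> real^3" where
  "jump_bd K F u y = elem_trace K u y *\<^sub>R outward_normal K F"

definition pd :: "3 \<Rightarrow> (real^3 \<Rightarrow> real) \<Rightarrow> real^3 \<Rightarrow> real" where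
  "pd i u x = frechet_derivative u (at x) (axis i 1)"

definition grad :: "(real^3 \<Rightarrow> real) \<Rightarrow> real^3 \<Rightarrow> real^3" where
  "grad u x = (\<chi> i. pd i u x)"

definition curl :: "(real^3 \<Rightarrow> real^3) \<Rightarrow> real^3 \<Rightarrow> real^3" where
  "curl U x = vector
     [pd 2 (\<lambda>y. U y $ 3) x - pd 3 (\<lambda>y. U y $ 2) x,
      pd 3 (\<lambda>y. U y $ 1) x - pd 1 (\<lambda>y. U y $ 3) x,
      pd 1 (\<lambda>y. U y $ 2) x - pd 2 (\<lambda>y. U y $ 1) x]"

text \<open>Time runs over \<open>[0,\<infinity>)\<close>; the derivative at time \<open>0\<close> is one-sided.\<close>

definition dt :: "(real \<Rightarrow> 'a \<Rightarrow> 'b::real_normed_vector) \<Rightarrow> real \<Rightarrow> 'a \<Rightarrow> 'b" where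
  "dt u t z = vector_derivative (\<lambda>\<tau>. u \<tau> z) (at t within {0..})"

definition accel :: "(real^3 \<Rightarrow> real^3) \<Rightarrow> (real^3 \<Rightarrow> real^3) \<Rightarrow> real^3 \<Rightarrow> real^3 \<Rightarrow> real^3" where
  "accel E B x \<xi> = E x + cross3 \<xi> (B x)"

definition flux_x :: "face \<Rightarrow> ((real^3) \<times> (real^3) \<Rightarrow> real) \<Rightarrow> real^3 \<Rightarrow> real^3 \<Rightarrow> real^3" where
  "flux_x e f x \<xi> =
     avg e (\<lambda>y. f (y, \<xi>) *\<^sub>R \<xi>) x
     + (\<bar>\<xi> \<bullet> normal_pos e\<bar> / 2) *\<^sub>R jump e (\<lambda>y. f (y, \<xi>)) x"

definition flux_xi :: "face \<Rightarrow> ((real^3) \<times> (real^3) \<Rightarrow> real) \<Rightarrow>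
    (real^3 \<Rightarrow> real^3) \<Rightarrow> (real^3 \<Rightarrow> real^3) \<Rightarrow> real^3 \<Rightarrow> real^3 \<Rightarrow> real^3" where
  "flux_xi e f E B x \<xi> =
     avg e (\<lambda>\<eta>. f (x, \<eta>) *\<^sub>R accel E B x \<eta>) \<xi>
     + (\<bar>accel E B x \<xi> \<bullet> normal_pos e\<bar> / 2) *\<^sub>R jump e (\<lambda>\<eta>. f (x, \<eta>)) \<xi>"

definition flux_xi_bd :: "(real^3) set \<Rightarrow> (real^3) set \<Rightarrow> ((real^3) \<times> (real^3) \<Rightarrow> real) \<Rightarrow>
    (real^3 \<Rightarrow> real^3) \<Rightarrow> (real^3 \<Rightarrow> real^3) \<Rightarrow> real^3 \<Rightarrow> real^3 \<Rightarrow> real^3" where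
  "flux_xi_bd K F f E B x \<xi> =
     avg_bd K (\<lambda>\<eta>. f (x, \<eta>) *\<^sub>R accel E B x \<eta>) \<xi>
     + (\<bar>accel E B x \<xi> \<bullet> outward_normal K F\<bar> / 2) *\<^sub>R jump_bd K F (\<lambda>\<eta>. f (x, \<eta>)) \<xi>"

datatype maxwell_flux = Upwind | Central | Alternating_pos_neg | Alternating_neg_pos

fun flux_E :: "maxwell_flux \<Rightarrow> face \<Rightarrow> (real^3 \<Rightarrow> real^3) \<Rightarrow> (real^3 \<Rightarrow> real^3) \<Rightarrow> real^3 \<Rightarrow> real^3" where
  "flux_E Upwind e E B x = avg e E x + (1/2) *\<^sub>R jump_tan e B x"
| "flux_E Central e E B x = avg e E x"
| "flux_E Alternating_pos_neg e E B x = trace_pos e E x"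
| "flux_E Alternating_neg_pos e E B x = trace_neg e E x"

fun flux_B :: "maxwell_flux \<Rightarrow> face \<Rightarrow> (real^3 \<Rightarrow> real^3) \<Rightarrow> (real^3 \<Rightarrow> real^3) \<Rightarrow> real^3 \<Rightarrow> real^3" where
  "flux_B Upwind e E B x = avg e B x - (1/2) *\<^sub>R jump_tan e E x"
| "flux_B Central e E B x = avg e B x"
| "flux_B Alternating_pos_neg e E B x = trace_neg e B x"
| "flux_B Alternating_neg_pos e E B x = trace_pos e B x"

definition a_h :: "dg_mesh \<Rightarrow> (real \<Rightarrow> (real^3) \<times> (real^3) \<Rightarrow> real) \<Rightarrow>
    (real \<Rightarrow> real^3 \<Rightarrow> real^3) \<Rightarrow> (real \<Rightarrow> real^3 \<Rightarrow> real^3) \<Rightarrow> real \<Rightarrow>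
    ((real^3) \<times> (real^3) \<Rightarrow> real) \<Rightarrow> real" where
  "a_h M f E B t g =
     mesh_integral (Th M) (\<lambda>z. dt f t z * g z)
     - mesh_integral (Th M) (\<lambda>(x, \<xi>). f t (x, \<xi>) * (\<xi> \<bullet> grad (\<lambda>y. g (y, \<xi>)) x))
     + mesh_integral (Txi M) (\<lambda>\<xi>. \<Sum>e\<in>Ex M. face_integral (face_set e)
         (\<lambda>x. flux_x e (f t) x \<xi> \<bullet> jump e (\<lambda>y. g (y, \<xi>)) x))
     - mesh_integral (Th M) (\<lambda>(x, \<xi>).
         f t (x, \<xi>) * (accel (E t) (B t) x \<xi> \<bullet> grad (\<lambda>\<eta>. g (x, \<eta>)) \<xi>))
     + mesh_integral (Tx M) (\<lambda>x.
         (\<Sum>e\<in>Exi M. face_integral (face_set e)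
           (\<lambda>\<xi>. flux_xi e (f t) (E t) (B t) x \<xi> \<bullet> jump e (\<lambda>\<eta>. g (x, \<eta>)) \<xi>))
         + (\<Sum>(K, F)\<in>Exi_bd M. face_integral F
           (\<lambda>\<xi>. flux_xi_bd K F (f t) (E t) (B t) x \<xi> \<bullet> jump_bd K F (\<lambda>\<eta>. g (x, \<eta>)) \<xi>)))"

definition b_h :: "dg_mesh \<Rightarrow> maxwell_flux \<Rightarrow>
    (real \<Rightarrow> real^3 \<Rightarrow> real^3) \<Rightarrow> (real \<Rightarrow> real^3 \<Rightarrow> real^3) \<Rightarrow> real \<Rightarrow>
    (real^3 \<Rightarrow> real^3) \<Rightarrow> (real^3 \<Rightarrow> real^3) \<Rightarrow> real" where
  "b_h M flux E B t U V =
     mesh_integral (Tx M) (\<lambda>x. dt E t x \<bullet> U x)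
     - mesh_integral (Tx M) (\<lambda>x. B t x \<bullet> curl U x)
     - (\<Sum>e\<in>Ex M. face_integral (face_set e)
         (\<lambda>x. flux_B flux e (E t) (B t) x \<bullet> jump_tan e U x))
     + mesh_integral (Tx M) (\<lambda>x. dt B t x \<bullet> V x)
     + mesh_integral (Tx M) (\<lambda>x. E t x \<bullet> curl V x)
     + (\<Sum>e\<in>Ex M. face_integral (face_set e)
         (\<lambda>x. flux_E flux e (E t) (B t) x \<bullet> jump_tan e V x))"

definition J_h :: "dg_mesh \<Rightarrow> ((real^3) \<times> (real^3) \<Rightarrow> real) \<Rightarrow> real^3 \<Rightarrow> real^3" where
  "J_h M f x = mesh_integral (Txi M) (\<lambda>\<xi>. f (x, \<xi>) *\<^sub>R \<xi>)"

definition l_h :: "dg_mesh \<Rightarrow> (real^3 \<Rightarrow> real^3) \<Rightarrow> (real^3 \<Rightarrow> real^3) \<Rightarrow> real" where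
  "l_h M J U = - mesh_integral (Tx M) (\<lambda>x. J x \<bullet> U x)"

definition dg_solution :: "dg_mesh \<Rightarrow> nat \<Rightarrow> nat \<Rightarrow> maxwell_flux \<Rightarrow>
    (real \<Rightarrow> (real^3) \<times> (real^3) \<Rightarrow> real) \<Rightarrow>
    (real \<Rightarrow> real^3 \<Rightarrow> real^3) \<Rightarrow> (real \<Rightarrow> real^3 \<Rightarrow> real^3) \<Rightarrow> bool" where
  "dg_solution M k r flux f E B \<longleftrightarrow> (\<forall>t\<ge>0.
     f t \<in> Gh M k \<and> E t \<in> Uh M r \<and> B t \<in> Uh M r \<and>
     (\<forall>K\<in>Th M. \<forall>z\<in>interior K. (\<lambda>\<tau>. f \<tau> z) differentiable (at t within {0..})) \<and>
     (\<forall>K\<in>Tx M. \<forall>x\<in>interior K. (\<lambda>\<tau>. E \<tau> x) differentiable (at t within {0..}) \<and>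
                                (\<lambda>\<tau>. B \<tau> x) differentiable (at t within {0..})) \<and>
     (\<forall>g\<in>Gh M k. a_h M f E B t g = 0) \<and>
     (\<forall>U\<in>Uh M r. \<forall>V\<in>Uh M r. b_h M flux E B t U V = l_h M (J_h M (f t)) U))"

definition rho_h :: "dg_mesh \<Rightarrow> ((real^3) \<times> (real^3) \<Rightarrow> real) \<Rightarrow> real^3 \<Rightarrow> real" where
  "rho_h M f x = mesh_integral (Txi M) (\<lambda>\<xi>. f (x, \<xi>))"

definition Theta1 :: "dg_mesh \<Rightarrow> ((real^3) \<times> (real^3) \<Rightarrow> real) \<Rightarrow>
    (real^3 \<Rightarrow> real^3) \<Rightarrow> (real^3 \<Rightarrow> real^3) \<Rightarrow> real" where
  "Theta1 M f E B =
     mesh_integral (Tx M) (\<lambda>x. \<Sum>(K, F)\<in>Exi_bd M. face_integral F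
       (\<lambda>\<xi>. elem_trace K (\<lambda>\<eta>. f (x, \<eta>)) \<xi> * max (accel E B x \<xi> \<bullet> outward_normal K F) 0))"

end

theory Submission
  imports Defs
begin

text \<open>The constant \<open>1\<close> is an admissible test function.  Its gradients vanish, and so do its
  jumps across interior and periodic faces, because the two outward normals are opposite:
  both are normals of a plane separating the elements.  Only the boundary fluxes in
  \<open>\<xi>\<close> survive, where \<open>(a + \<bar>a\<bar>)/2 = max a 0\<close>.  Since \<open>f t\<close> ranges over a
  finite-dimensional space on each element, the time derivative passes under the integral,
  and the fundamental theorem of calculus gives the integrated form.\<close>

section \<open>Lebesgue integrals\<close>

text \<open>Completeness of Lebesgue measure carries measurability across an a.e. equality, so
  either both functions are measurable or neither is. In the second case both integrals have the
  default value 0.\<close>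

lemma integral_lebesgue_cong_AE:
  fixes f g :: "'a::euclidean_space \<Rightarrow> 'b::euclidean_space"
  assumes "AE x in lebesgue. f x = g x"
  shows "integral\<^sup>L lebesgue f = integral\<^sup>L lebesgue g"
proof (cases "f \<in> borel_measurable lebesgue")
  case True
  moreover have "g \<in> borel_measurable lebesgue"
    using True assms by (rule borel_measurable_AE)
  ultimately show ?thesis
    using assms by (intro integral_cong_AE)
next
  case False
  have "AE x in lebesgue. g x = f x"
    using assms by (rule AE_mp) auto
  then have "g \<notin> borel_measurable lebesgue"
    using False borel_measurable_AE by blast
  with False have "\<not> integrable lebesgue f" "\<not> integrable lebesgue g"
    using borel_measurable_integrable by blast+
  then show ?thesis
    by (simp add: not_integrable_integral_eq)
qed

text \<open>The frontier of a convex set is a null set. Mesh functions are prescribed on open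
  elements only, and this makes their values on the skeleton irrelevant to integrals.\<close>

lemma set_lebesgue_integral_cong_interior:
  fixes f g :: "'a::euclidean_space \<Rightarrow> 'b::euclidean_space"
  assumes "convex K" and eq: "\<And>x. x \<in> interior K \<Longrightarrow> f x = g x"
  shows "(LINT x:K|lebesgue. f x) = (LINT x:K|lebesgue. g x)"
proof -
  have "frontier K \<in> null_sets lebesgue"
    using assms(1) negligible_convex_frontier negligible_iff_null_sets by blast
  then have "AE x in lebesgue. x \<notin> frontier K"
    by (rule AE_not_in)
  then have "AE x in lebesgue. indicator K x *\<^sub>R f x = indicator K x *\<^sub>R g x"
  proof (rule AE_mp, intro AE_I2 impI)
    fix x assume "x \<notin> frontier K"
    then have "x \<in> K \<Longrightarrow> x \<in> interior K"
      using closure_subset by (auto simp: frontier_def)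
    then show "indicator K x *\<^sub>R f x = indicator K x *\<^sub>R g x"
      using eq by (cases "x \<in> K") auto
  qed
  then show ?thesis
    unfolding set_lebesgue_integral_def by (rule integral_lebesgue_cong_AE)
qed

lemma borel_measurable_indicator_compact:
  fixes p :: "'a::euclidean_space \<Rightarrow> 'b::euclidean_space"
  assumes "compact K" "continuous_on UNIV p"
  shows "(\<lambda>x. indicator K x *\<^sub>R p x) \<in> borel_measurable lborel"
  using borel_integrable_compact[OF assms(1) continuous_on_subset[OF assms(2)]]
  by (simp add: borel_measurable_integrable)

lemma set_integrable_lebesgue_compact:
  fixes p :: "'a::euclidean_space \<Rightarrow> 'b::euclidean_space"
  assumes "compact K" "continuous_on UNIV p"
  shows "set_integrable lebesgue K p"
  unfolding set_integrable_def
  using borel_integrable_compact[OF assms(1) continuous_on_subset[OF assms(2)]]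
    borel_measurable_indicator_compact[OF assms] by (simp add: integrable_completion)

lemma set_lebesgue_integral_compact_eq_lborel:
  fixes p :: "'a::euclidean_space \<Rightarrow> 'b::euclidean_space"
  assumes "compact K" "continuous_on UNIV p"
  shows "(LINT x:K|lebesgue. p x) = (LINT x:K|lborel. p x)"
  unfolding set_lebesgue_integral_def
  by (rule integral_completion[OF borel_measurable_indicator_compact[OF assms]])

text \<open>Fubini is applied in \<open>lborel\<close>, which is a product measure on the pair
  space; \<open>lebesgue\<close> there is only its completion. For continuous integrands on compact
  sets the two kinds of integral agree, so one can pass from one to the other and back.\<close>

lemma
  fixes p :: "'a::euclidean_space \<times> 'b::euclidean_space \<Rightarrow> 'c::euclidean_space"
  assumes A: "compact A" and B: "compact B" and p: "continuous_on UNIV p"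
  shows set_integrable_lebesgue_section:
      "set_integrable lebesgue A (\<lambda>x. LINT y:B|lebesgue. p (x, y))"
    and set_lebesgue_integral_Times:
      "(LINT z:A\<times>B|lebesgue. p z) = (LINT x:A|lebesgue. LINT y:B|lebesgue. p (x, y))"
proof -
  have sect: "continuous_on UNIV (\<lambda>y. p (x, y))" for x
    using p by (intro continuous_on_compose2[OF p] continuous_intros) auto
  let ?g = "\<lambda>z. indicator (A \<times> B) z *\<^sub>R p z"
  have int: "integrable lborel ?g"
    using A B p by (intro borel_integrable_compact compact_Times continuous_on_subset[OF p]) auto
  have int': "integrable (lborel \<Otimes>\<^sub>M lborel) ?g"
    using int by (simp add: lborel_prod)
  define h where "h x = (LINT y:B|lborel. p (x, y))" for x
  have g: "(\<integral>y. ?g (x, y) \<partial>lborel) = indicator A x *\<^sub>R h x" for x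
    by (auto simp: h_def set_lebesgue_integral_def indicator_times split: split_indicator)
  have h: "integrable lborel (\<lambda>x. indicator A x *\<^sub>R h x)"
    using lborel_pair.integrable_fst'[OF int'] unfolding g .
  then have meas: "(\<lambda>x. indicator A x *\<^sub>R h x) \<in> borel_measurable lborel"
    by (rule borel_measurable_integrable)
  have "integrable lebesgue (\<lambda>x. indicator A x *\<^sub>R h x)"
    using h meas by (simp add: integrable_completion)
  then show "set_integrable lebesgue A (\<lambda>x. LINT y:B|lebesgue. p (x, y))"
    by (simp add: set_integrable_def h_def set_lebesgue_integral_compact_eq_lborel[OF B sect])
  have "(LINT z:A\<times>B|lebesgue. p z) = integral\<^sup>L lborel ?g"
    using set_lebesgue_integral_compact_eq_lborel[OF compact_Times[OF A B] p]
    by (simp add: set_lebesgue_integral_def)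
  also have "\<dots> = (\<integral>x. \<integral>y. ?g (x, y) \<partial>lborel \<partial>lborel)"
    using lborel_pair.integral_fst'[OF int'] by (simp add: lborel_prod)
  also have "\<dots> = (\<integral>x. indicator A x *\<^sub>R h x \<partial>lebesgue)"
    unfolding g using meas by (rule integral_completion[symmetric])
  also have "\<dots> = (LINT x:A|lebesgue. LINT y:B|lebesgue. p (x, y))"
    unfolding set_lebesgue_integral_def[of lebesgue A] h_def
    by (simp add: set_lebesgue_integral_compact_eq_lborel[OF B sect])
  finally show "(LINT z:A\<times>B|lebesgue. p z) = (LINT x:A|lebesgue. LINT y:B|lebesgue. p (x, y))" .
qed

section \<open>Interpolation in the polynomial spaces\<close>

text \<open>Interpolation in the span of finitely many functions, by a Newton-type induction. When a
  function \<open>\<phi> a\<close> joins, either the old nodes already reproduce it on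
  \<open>S\<close>, or a point where they fail becomes a new node; linear dependence is thus
  absorbed by the case split.\<close>

lemma finite_dim_interpolation:
  fixes \<phi> :: "'i \<Rightarrow> 'a::topological_space \<Rightarrow> real"
  assumes "finite A" "\<And>\<alpha>. \<alpha> \<in> A \<Longrightarrow> continuous_on UNIV (\<phi> \<alpha>)"
  shows "\<exists>(N::nat) z L. (\<forall>i<N. z i \<in> S \<and> continuous_on UNIV (L i)) \<and>
    (\<forall>c. \<forall>x\<in>S. (\<Sum>\<alpha>\<in>A. c \<alpha> * \<phi> \<alpha> x) = (\<Sum>i<N. (\<Sum>\<alpha>\<in>A. c \<alpha> * \<phi> \<alpha> (z i)) * L i x))"
  using assms
proof (induction A rule: finite_induct)
  case empty
  show ?case by (rule exI[of _ 0]) auto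
next
  case (insert a A)
  obtain N :: nat and z and L :: "nat \<Rightarrow> 'a \<Rightarrow> real"
    where zL: "\<And>i. i < N \<Longrightarrow> z i \<in> S" "\<And>i. i < N \<Longrightarrow> continuous_on UNIV (L i)"
      and int: "\<And>c x. x \<in> S \<Longrightarrow>
        (\<Sum>\<alpha>\<in>A. c \<alpha> * \<phi> \<alpha> x) = (\<Sum>i<N. (\<Sum>\<alpha>\<in>A. c \<alpha> * \<phi> \<alpha> (z i)) * L i x)"
    using insert.IH insert.prems by auto metis
  \<comment> \<open>The interpolation error of the new function at the old nodes.\<close>
  define \<psi> where "\<psi> x = \<phi> a x - (\<Sum>i<N. \<phi> a (z i) * L i x)" for x
  have \<psi>: "continuous_on UNIV \<psi>"
    unfolding \<psi>_def using zL insert.prems by (intro continuous_intros) auto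
  define G where "G c x = (\<Sum>\<alpha>\<in>insert a A. c \<alpha> * \<phi> \<alpha> x)" for c x
  \<comment> \<open>The old nodes are exact on the span of \<open>A\<close>, so only the share
    \<open>c a\<close> of the new function leaves an error.\<close>
  have residual: "G c x = (\<Sum>i<N. G c (z i) * L i x) + c a * \<psi> x" if "x \<in> S" for c x
  proof -
    have "G c y = (\<Sum>\<alpha>\<in>A. c \<alpha> * \<phi> \<alpha> y) + c a * \<phi> a y" for y
      using insert.hyps by (simp add: G_def)
    then show ?thesis
      using int[OF that, of c]
      by (simp add: \<psi>_def algebra_simps sum.distrib sum_distrib_left)
  qed
  show ?case
  proof (cases "\<forall>x\<in>S. \<psi> x = 0")
    case True
    then show ?thesis
      using zL residual unfolding G_def
      by (intro exI[of _ N] exI[of _ z] exI[of _ L]) simp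
  next
    case False
    then obtain w where w: "w \<in> S" "\<psi> w \<noteq> 0" by auto
    \<comment> \<open>The function of the new node \<open>w\<close> is the error scaled to be 1 at
      \<open>w\<close>; the old functions are corrected so as to vanish there.\<close>
    define L' where "L' i x = (if i < N then L i x - L i w * (\<psi> x / \<psi> w) else \<psi> x / \<psi> w)" for i x
    have cont: "continuous_on UNIV (L' i)" for i
      using zL(2)[of i] \<psi> w(2) unfolding L'_def
      by (cases "i < N") (auto intro!: continuous_intros)
    have "G c x = (\<Sum>i<Suc N. G c ((z(N := w)) i) * L' i x)" if "x \<in> S" for c x
    proof -
      \<comment> \<open>The identity \<open>residual\<close> at \<open>w\<close>, solved for
        \<open>c a\<close>: the value at the new node determines the missing coefficient.\<close>
      have ca: "c a = (G c w - (\<Sum>i<N. G c (z i) * L i w)) / \<psi> w"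
        using residual[OF w(1), of c] w(2) by (simp add: field_simps)
      have "(\<Sum>i<Suc N. G c ((z(N := w)) i) * L' i x) =
          (\<Sum>i<N. G c (z i) * (L i x - L i w * (\<psi> x / \<psi> w))) + G c w * (\<psi> x / \<psi> w)"
        by (simp add: L'_def)
      also have "\<dots> = (\<Sum>i<N. G c (z i) * L i x) + c a * \<psi> x"
      proof -
        have "(\<Sum>i<N. G c (z i) * (L i x - L i w * (\<psi> x / \<psi> w))) =
          (\<Sum>i<N. G c (z i) * L i x) - (\<Sum>i<N. G c (z i) * L i w) * (\<psi> x / \<psi> w)"
          by (simp only: right_diff_distrib sum_subtractf sum_distrib_right mult.assoc)
        then show ?thesis
          by (simp only: ca) (simp add: left_diff_distrib diff_divide_distrib)
      qed
      finally show ?thesis using residual[OF that, of c] by simp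
    qed
    moreover have "\<forall>i<Suc N. (z(N := w)) i \<in> S \<and> continuous_on UNIV (L' i)"
      using zL(1) w(1) cont by simp
    ultimately show ?thesis
      unfolding G_def by blast
  qed
qed

lemma finite_multi_indices:
  "finite {\<alpha>. \<alpha> \<in> (Basis :: 'a::euclidean_space set) \<rightarrow>\<^sub>E {..m::nat} \<and> sum \<alpha> Basis \<le> m}"
  by (rule finite_subset[OF _ finite_PiE[of Basis "\<lambda>_. {..m}"]]) auto

lemma poly_space_continuous: "p \<in> poly_space m \<Longrightarrow> continuous_on UNIV p"
proof -
  assume "p \<in> poly_space m"
  then obtain c where "p = (\<lambda>z. \<Sum>\<alpha> | \<alpha> \<in> Basis \<rightarrow>\<^sub>E {..m} \<and> sum \<alpha> Basis \<le> m.
      c \<alpha> * (\<Prod>b\<in>Basis. (z \<bullet> b) ^ \<alpha> b))"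
    unfolding poly_space_def by auto
  then show ?thesis
    by (auto intro!: continuous_intros)
qed

lemma one_in_poly_space: "(\<lambda>_. 1) \<in> poly_space m"
proof -
  let ?A = "{\<alpha>. \<alpha> \<in> (Basis :: 'a set) \<rightarrow>\<^sub>E {..m::nat} \<and> sum \<alpha> Basis \<le> m}"
  \<comment> \<open>The zero multi-index. The restricted lambda makes it \<open>undefined\<close>
    off \<open>Basis\<close>, as membership in \<open>\<rightarrow>\<^sub>E\<close> demands.\<close>
  define \<alpha>0 where "\<alpha>0 = (\<lambda>b\<in>(Basis :: 'a set). 0::nat)"
  have "\<alpha>0 \<in> ?A" by (auto simp: \<alpha>0_def)
  then have "(\<Sum>\<alpha>\<in>?A. (if \<alpha> = \<alpha>0 then 1 else 0) * (\<Prod>b\<in>Basis. (z \<bullet> b) ^ \<alpha> b))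
      = (\<Prod>b\<in>Basis. (z \<bullet> b) ^ \<alpha>0 b)" for z :: 'a
    using finite_multi_indices[where 'a='a and m=m]
    by (simp add: if_distrib[of "\<lambda>x. x * _"] cong: if_cong)
  moreover have "(\<Prod>b\<in>Basis. (z \<bullet> b) ^ \<alpha>0 b) = 1" for z :: 'a
    by (simp add: \<alpha>0_def)
  ultimately show ?thesis
    unfolding poly_space_def mem_Collect_eq
    by (intro exI[of _ "\<lambda>\<alpha>. if \<alpha> = \<alpha>0 then 1 else 0"]) simp
qed

text \<open>Nodes and functions are chosen before \<open>p\<close>, so a single choice serves a
  whole family of polynomials, such as the states at all times.\<close>

lemma poly_space_interpolation:
  fixes S :: "'a::euclidean_space set"
  obtains N :: nat and z L
  where "\<And>i. i < N \<Longrightarrow> z i \<in> S" "\<And>i. i < N \<Longrightarrow> continuous_on UNIV (L i)"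
    "\<And>(p :: 'a \<Rightarrow> real) x. p \<in> poly_space m \<Longrightarrow> x \<in> S \<Longrightarrow> p x = (\<Sum>i<N. p (z i) * L i x)"
proof -
  let ?A = "{\<alpha>. \<alpha> \<in> (Basis :: 'a set) \<rightarrow>\<^sub>E {..m::nat} \<and> sum \<alpha> Basis \<le> m}"
  let ?\<phi> = "\<lambda>\<alpha> x::'a. \<Prod>b\<in>Basis. (x \<bullet> b) ^ \<alpha> b"
  have cont: "continuous_on UNIV (?\<phi> \<alpha>)" for \<alpha>
    by (intro continuous_intros)
  obtain N :: nat and z and L :: "nat \<Rightarrow> 'a \<Rightarrow> real"
    where zL: "\<forall>i<N. z i \<in> S \<and> continuous_on UNIV (L i)"
      and int: "\<forall>c. \<forall>x\<in>S. (\<Sum>\<alpha>\<in>?A. c \<alpha> * ?\<phi> \<alpha> x) = (\<Sum>i<N. (\<Sum>\<alpha>\<in>?A. c \<alpha> * ?\<phi> \<alpha> (z i)) * L i x)"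
    using finite_dim_interpolation[where A="?A" and \<phi>="?\<phi>" and S=S, OF finite_multi_indices cont]
    by (elim exE conjE) (rule that)
  show thesis
  proof (rule that[of N z L])
    fix p :: "'a \<Rightarrow> real" and x assume "p \<in> poly_space m" "x \<in> S"
    then obtain c where "\<And>z. p z = (\<Sum>\<alpha>\<in>?A. c \<alpha> * (\<Prod>b\<in>Basis. (z \<bullet> b) ^ \<alpha> b))"
      unfolding poly_space_def by auto
    with int \<open>x \<in> S\<close> show "p x = (\<Sum>i<N. p (z i) * L i x)"
      by simp
  qed (use zL in auto)
qed

section \<open>Time derivatives of integrals over an element\<close>

lemma at_within_atLeast_neq_bot:
  fixes t :: real assumes "t \<ge> 0"
  shows "at t within {0..} \<noteq> bot"
proof -
  have "t \<in> {t..t+1}" "{t..t+1} \<subseteq> {0..}" using assms by auto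
  moreover have "at t within {t..t+1} \<noteq> bot" by (simp add: trivial_limit_within)
  ultimately show ?thesis
    by (metis at_le bot.extremum_uniqueI)
qed

lemma has_vector_derivative_dt:
  fixes u :: "real \<Rightarrow> 'a \<Rightarrow> 'b::real_normed_vector"
  assumes "(\<lambda>\<tau>. u \<tau> z) differentiable (at t within {0..})"
  shows "((\<lambda>\<tau>. u \<tau> z) has_vector_derivative dt u t z) (at t within {0..})"
  unfolding dt_def using assms vector_derivative_works by blast

text \<open>Differentiation under the integral needs no uniformity in \<open>z\<close>: interpolation writes
  \<open>u \<tau>\<close> as a combination of fixed functions with the coefficients \<open>u \<tau> (z i)\<close>.\<close>

lemma has_real_derivative_integral_poly_space:
  fixes u :: "real \<Rightarrow> 'a::euclidean_space \<Rightarrow> real"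
  assumes K: "convex K" "compact K"
    and poly: "\<And>\<tau>. \<tau> \<ge> 0 \<Longrightarrow> \<exists>p\<in>poly_space m. \<forall>z\<in>interior K. u \<tau> z = p z"
    and diff: "\<And>z. z \<in> interior K \<Longrightarrow> (\<lambda>\<tau>. u \<tau> z) differentiable (at t within {0..})"
    and t: "t \<ge> 0"
  shows "((\<lambda>\<tau>. LINT z:K|lebesgue. u \<tau> z) has_real_derivative (LINT z:K|lebesgue. dt u t z))
    (at t within {0..})"
proof -
  obtain N :: nat and z and L :: "nat \<Rightarrow> 'a \<Rightarrow> real"
    where z: "\<And>i. i < N \<Longrightarrow> z i \<in> interior K" and L: "\<And>i. i < N \<Longrightarrow> continuous_on UNIV (L i)"
    and int: "\<And>p x. p \<in> poly_space m \<Longrightarrow> x \<in> interior K \<Longrightarrow> p x = (\<Sum>i<N. p (z i) * L i x)"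
    using poly_space_interpolation[of "interior K" m] by metis
  have u: "u \<tau> x = (\<Sum>i<N. u \<tau> (z i) * L i x)" if \<tau>: "\<tau> \<ge> 0" and x: "x \<in> interior K" for \<tau> x
  proof -
    obtain p where "p \<in> poly_space m" "\<forall>z\<in>interior K. u \<tau> z = p z"
      using poly[OF \<tau>] by auto
    then show ?thesis using int[of p x] x z by simp
  qed
  have der: "((\<lambda>\<tau>. u \<tau> x) has_real_derivative dt u t x) (at t within {0..})"
    if "x \<in> interior K" for x
    using has_vector_derivative_dt[of u, OF diff[OF that]]
    by (simp add: has_real_derivative_iff_has_vector_derivative)
  have dt: "dt u t x = (\<Sum>i<N. dt u t (z i) * L i x)" if x: "x \<in> interior K" for x
  proof -
    have "((\<lambda>\<tau>. \<Sum>i<N. u \<tau> (z i) * L i x) has_real_derivative (\<Sum>i<N. dt u t (z i) * L i x))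
        (at t within {0..})"
      using z by (intro DERIV_sum DERIV_cmult_right der) auto
    \<comment> \<open>The representation of \<open>u\<close> holds at all nonnegative times, so any
      radius would do in place of 1.\<close>
    then have "((\<lambda>\<tau>. u \<tau> x) has_real_derivative (\<Sum>i<N. dt u t (z i) * L i x))
        (at t within {0..})"
      by (rule has_field_derivative_transform_within[OF _ zero_less_one]) (use t u x in auto)
    \<comment> \<open>Two derivatives of one function within \<open>{0..}\<close> coincide; this
      includes the one-sided derivative at time 0.\<close>
    then show ?thesis
      using der[OF x] vector_derivative_unique_within[OF at_within_atLeast_neq_bot[OF t]]
      by (auto simp: has_real_derivative_iff_has_vector_derivative)
  qed
  have integral: "(LINT x:K|lebesgue. \<Sum>i<N. c i * L i x) = (\<Sum>i<N. c i * (LINT x:K|lebesgue. L i x))"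
    for c
  proof -
    have "integrable lebesgue (\<lambda>x. indicator K x *\<^sub>R L i x)" if "i < N" for i
      using set_integrable_lebesgue_compact[OF K(2) L[OF that]] by (simp add: set_integrable_def)
    then show ?thesis
      by (simp add: set_lebesgue_integral_def sum_distrib_left mult.left_commute)
  qed
  have "((\<lambda>\<tau>. \<Sum>i<N. u \<tau> (z i) * (LINT x:K|lebesgue. L i x)) has_real_derivative
      (\<Sum>i<N. dt u t (z i) * (LINT x:K|lebesgue. L i x))) (at t within {0..})"
    using z by (intro DERIV_sum DERIV_cmult_right der) auto
  moreover have "(LINT x:K|lebesgue. u \<tau> x) = (\<Sum>i<N. u \<tau> (z i) * (LINT x:K|lebesgue. L i x))"
    if "\<tau> \<ge> 0" for \<tau>
    unfolding integral[symmetric] using K(1) by (rule set_lebesgue_integral_cong_interior) (use u that in auto)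
  moreover have "(LINT x:K|lebesgue. dt u t x) = (\<Sum>i<N. dt u t (z i) * (LINT x:K|lebesgue. L i x))"
    unfolding integral[symmetric] using K(1) by (rule set_lebesgue_integral_cong_interior) (use dt in auto)
  ultimately show ?thesis
    using t by (auto intro: has_field_derivative_transform_within[OF _ zero_less_one])
qed

section \<open>Mesh elements, normals and traces\<close>

lemma mesh_of_element:
  assumes "mesh_of T D" "K \<in> T"
  shows "convex K" "compact K" "interior K \<noteq> {}"
proof -
  have "convex K \<and> compact K \<and> interior K \<noteq> {}"
  proof (cases "cartesian_element K")
    case True
    then obtain R :: "real^3 \<Rightarrow> real^3" and a b
      where R: "orthogonal_transformation R" and ab: "box a b \<noteq> {}" and K: "K = R ` cbox a b"
      unfolding cartesian_element_def by auto
    have "linear R" "inj R"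
      using R by (auto intro: orthogonal_transformation_linear orthogonal_transformation_inj)
    then have "interior K = R ` box a b"
      unfolding K by (simp add: interior_injective_linear_image interior_cbox)
    moreover have "convex K" "compact K"
      unfolding K using \<open>linear R\<close>
      by (auto intro: convex_linear_image compact_continuous_image linear_continuous_on
          simp: linear_conv_bounded_linear)
    ultimately show ?thesis using ab by auto
  next
    case False
    then have K: "3 simplex K"
      using assms by (auto simp: mesh_of_def)
    then have "convex K" "compact K" "aff_dim K = 3"
      by (auto intro: convex_simplex compact_simplex aff_dim_simplex)
    moreover have "interior K \<noteq> {}"
    proof -
      \<comment> \<open>Full dimension identifies the interior with the relative interior, which is
        nonempty for a nonempty convex set.\<close>
      have "interior K = rel_interior K"
        using \<open>aff_dim K = 3\<close> by (simp add: interior_rel_interior_gen)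
      moreover have "K \<noteq> {}" using \<open>aff_dim K = 3\<close> by auto
      ultimately show ?thesis using \<open>convex K\<close> by (simp add: rel_interior_eq_empty)
    qed
    ultimately show ?thesis by blast
  qed
  then show "convex K" "compact K" "interior K \<noteq> {}" by auto
qed

lemma mesh_of_subset: "mesh_of T D \<Longrightarrow> K \<in> T \<Longrightarrow> K \<subseteq> closure D"
  by (auto simp: mesh_of_def)

text \<open>Uniqueness behind the definite description. A vector that is maximal over
  \<open>K\<close> at every point of \<open>F\<close> is constant on \<open>F\<close>, hence normal
  to the plane of \<open>F\<close>. Two unit candidates therefore agree up to sign, and opposite
  signs would force \<open>K\<close> into a plane.\<close>

lemma outward_normal_eqI:
  assumes F: "aff_dim F = 2" "F \<subseteq> K" and K: "interior K \<noteq> {}"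
    and n: "norm n = 1" "\<And>x y. x \<in> F \<Longrightarrow> y \<in> K \<Longrightarrow> n \<bullet> y \<le> n \<bullet> x"
  shows "outward_normal K F = n"
  unfolding outward_normal_def
proof (rule the_equality)
  show "norm n = 1 \<and> (\<forall>x\<in>F. \<forall>y\<in>K. n \<bullet> y \<le> n \<bullet> x)" using n by auto
next
  fix m assume m: "norm m = 1 \<and> (\<forall>x\<in>F. \<forall>y\<in>K. m \<bullet> y \<le> m \<bullet> x)"
  have "F \<noteq> {}" using F by auto
  then obtain x0 where x0: "x0 \<in> F" by auto
  obtain a b where a: "a \<noteq> 0" and hull: "affine hull F = {x. a \<bullet> x = b}"
    using F(1) aff_dim_eq_hyperplane[of F] by auto
  have multiple: "\<exists>c. v = c *\<^sub>R a" if v: "\<forall>x\<in>F. \<forall>y\<in>K. v \<bullet> y \<le> v \<bullet> x" for v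
  proof -
    have "F \<subseteq> {x. v \<bullet> x = v \<bullet> x0}"
      using v x0 F(2) by (auto intro: antisym)
    then have sub: "{x. a \<bullet> x = b} \<subseteq> {x. v \<bullet> x = v \<bullet> x0}"
      unfolding hull[symmetric] by (intro hull_minimal affine_hyperplane)
    have "a \<bullet> x0 = b" using x0 hull hull_subset[of F affine] by auto
    define c where "c = (a \<bullet> v) / (a \<bullet> a)"
    \<comment> \<open>The part of \<open>v\<close> orthogonal to \<open>a\<close>. A move from
      \<open>x0\<close> along \<open>w\<close> stays in the plane, where \<open>v\<close> is
      constant, so \<open>w\<close> is orthogonal to \<open>v\<close> as well as to \<open>a\<close>
      and must vanish.\<close>
    define w where "w = v - c *\<^sub>R a"
    have aw: "a \<bullet> w = 0"
      using a by (simp add: w_def c_def inner_diff_right)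
    then have "x0 + w \<in> {x. a \<bullet> x = b}"
      using \<open>a \<bullet> x0 = b\<close> by (simp add: inner_add_right)
    then have "v \<bullet> (x0 + w) = v \<bullet> x0"
      using sub by blast
    then have "v \<bullet> w = 0" by (simp add: inner_add_right)
    then have "w \<bullet> w = 0"
      using aw inner_diff_left[of v "c *\<^sub>R a" w] by (simp flip: w_def)
    then show ?thesis unfolding w_def by auto
  qed
  obtain c where c: "n = c *\<^sub>R a" using multiple n(2) by blast
  obtain d where d: "m = d *\<^sub>R a" using multiple m by blast
  have "\<bar>c\<bar> * norm a = \<bar>d\<bar> * norm a" using n(1) m c d by simp
  then have "\<bar>c\<bar> = \<bar>d\<bar>" using a by simp
  then have "m = n \<or> m = - n" unfolding c d by (auto simp: abs_if split: if_splits)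
  moreover have "m \<noteq> - n"
  proof
    assume "m = - n"
    then have "K \<subseteq> {y. n \<bullet> y = n \<bullet> x0}"
      using n(2) m x0 by (fastforce intro: antisym)
    then have "interior K \<subseteq> interior {y. n \<bullet> y = n \<bullet> x0}" by (rule interior_mono)
    moreover have "n \<noteq> 0" using n(1) by auto
    ultimately show False using K by simp
  qed
  ultimately show "m = n" by blast
qed

text \<open>Separation is applied to \<open>interior A\<close> and extended to \<open>A\<close> by
  closure. Only \<open>A\<close> must have interior points, so that \<open>C\<close> may be a
  neighbouring element or a flat facet.\<close>

lemma separating_unit_normal:
  fixes A C :: "'a::euclidean_space set"
  assumes A: "convex A" "interior A \<noteq> {}" and C: "convex C" "C \<noteq> {}" and disj: "interior A \<inter> C = {}"
  obtains n where "norm n = 1" "\<And>x y. x \<in> C \<Longrightarrow> y \<in> A \<Longrightarrow> n \<bullet> y \<le> n \<bullet> x"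
proof -
  obtain a b where a: "a \<noteq> 0" and le: "\<forall>y\<in>interior A. a \<bullet> y \<le> b" and ge: "\<forall>x\<in>C. a \<bullet> x \<ge> b"
    using separating_hyperplane_sets[OF convex_interior[OF A(1)] C(1) A(2) C(2) disj] by auto
  have "closure (interior A) \<subseteq> {y. a \<bullet> y \<le> b}"
    using le by (intro closure_minimal closed_halfspace_le) auto
  then have le': "\<forall>y\<in>A. a \<bullet> y \<le> b"
    using convex_closure_interior[OF A] closure_subset[of A] by auto
  show thesis
  proof (rule that[of "a /\<^sub>R norm a"])
    show "norm (a /\<^sub>R norm a) = 1" using a by simp
    show "(a /\<^sub>R norm a) \<bullet> y \<le> (a /\<^sub>R norm a) \<bullet> x" if "x \<in> C" "y \<in> A" for x y
    proof -
      have "a \<bullet> y \<le> a \<bullet> x" using le' ge that by (blast intro: order_trans)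
      then show ?thesis using a by (simp add: divide_right_mono)
    qed
  qed
qed

text \<open>The normal of a separating plane, directed from \<open>A\<close> to \<open>C\<close>, is
  outward for \<open>A\<close> along \<open>F\<close>, and its negative is outward for
  \<open>C\<close>, because \<open>F\<close> lies in both sets.\<close>

lemma outward_normal_opposite:
  assumes A: "convex A" "interior A \<noteq> {}" and C: "convex C" "interior C \<noteq> {}"
    and disj: "interior A \<inter> interior C = {}" and F: "F \<subseteq> A" "F \<subseteq> C" "aff_dim F = 2"
  shows "outward_normal C F = - outward_normal A F"
proof -
  \<comment> \<open>An open set that misses \<open>interior C\<close> also misses its closure, which
    contains \<open>C\<close>.\<close>
  have "interior A \<inter> C = {}"
    using disj convex_closure_interior[OF C] closure_subset[of C]
      open_Int_closure_eq_empty[of "interior A" "interior C"] by auto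
  moreover have "C \<noteq> {}" using C interior_subset by blast
  ultimately obtain n where n: "norm n = 1" "\<And>x y. x \<in> C \<Longrightarrow> y \<in> A \<Longrightarrow> n \<bullet> y \<le> n \<bullet> x"
    using separating_unit_normal[OF A C(1)] by metis
  have "outward_normal A F = n"
    by (rule outward_normal_eqI) (use n F A in auto)
  moreover have "outward_normal C F = - n"
    by (rule outward_normal_eqI) (use n F C in auto)
  ultimately show ?thesis by simp
qed

text \<open>The definite description has unit length only once a normal is known to exist. One is
  obtained by separating \<open>K\<close> from the facet, which does not meet the interior.\<close>

lemma norm_outward_normal_facet:
  assumes K: "convex K" "interior K \<noteq> {}" and F: "F facet_of K"
  shows "norm (outward_normal K F) = 1"
proof -
  have dim: "aff_dim F = 2"
    using F aff_dim_nonempty_interior[OF K(2)] by (simp add: facet_of_def)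
  have "F \<noteq> {}" "F \<subseteq> K" "F face_of K" "F \<noteq> K"
    using F by (auto simp: facet_of_def face_of_imp_subset)
  then have "convex F" "interior K \<inter> F = {}"
    using face_of_disjoint_interior[of F K] by (auto intro: face_of_imp_convex)
  then obtain n where n: "norm n = 1" "\<And>x y. x \<in> F \<Longrightarrow> y \<in> K \<Longrightarrow> n \<bullet> y \<le> n \<bullet> x"
    using separating_unit_normal[OF K _ \<open>F \<noteq> {}\<close>] by metis
  have "outward_normal K F = n"
    by (rule outward_normal_eqI) (use n dim K \<open>F \<subseteq> K\<close> in auto)
  with n show ?thesis by simp
qed

text \<open>Every point of a convex body is a limit point of its interior, so the limit that defines
  the trace is unique and is found from the continuous \<open>v\<close>.\<close>

lemma elem_trace_eq:
  assumes K: "convex K" "interior K \<noteq> {}" and y: "y \<in> K"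
    and u: "\<And>x. x \<in> interior K \<Longrightarrow> u x = v x" and v: "continuous_on UNIV v"
  shows "elem_trace K u y = v y"
proof -
  have "y \<in> closure (interior K)"
    using convex_closure_interior[OF K] closure_subset y by blast
  then have "y islimpt interior K"
    by (cases "y \<in> interior K") (auto simp: closure_def intro: interior_limit_point islimpt_subset)
  then have nontriv: "at y within interior K \<noteq> bot"
    by (simp add: trivial_limit_within)
  have "(v \<longlongrightarrow> v y) (at y within interior K)"
    using v continuous_on_def continuous_on_subset by (metis UNIV_I tendsto_within_subset subset_UNIV)
  then have "(u \<longlongrightarrow> v y) (at y within interior K)"
    by (rule Lim_transform_eventually) (use u in \<open>auto simp: eventually_at_filter\<close>)
  then show ?thesis
    unfolding elem_trace_def by (intro tendsto_Lim nontriv)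
qed

lemma elem_trace_one:
  assumes "convex K" "interior K \<noteq> {}" "y \<in> K"
  shows "elem_trace K (\<lambda>_. 1 :: real) y = 1"
  by (rule elem_trace_eq[OF assms]) auto

text \<open>Disjointness of the two interiors is assumed here because its source varies: the mesh
  itself for ordinary faces, the geometry of the cell for periodic ones.\<close>

lemma jump_one:
  assumes T: "mesh_of T D" and e: "e \<in> adjacent \<Lambda> T"
    and disj: "interior (pos e) \<inter> interior (neg_image e) = {}" and y: "y \<in> face_set e"
  shows "jump e (\<lambda>_. 1) y = 0"
proof -
  have mem: "pos e \<in> T" "neg e \<in> T" and dim: "aff_dim (face_set e) = 2"
    using e by (auto simp: adjacent_def)
  note pos = mesh_of_element[OF T mem(1)] and neg = mesh_of_element[OF T mem(2)]
  have ni: "neg_image e = (+) (shift e) ` neg e"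
    unfolding neg_image_def by (auto simp: add.commute)
  have "convex (neg_image e)" "interior (neg_image e) \<noteq> {}"
    using neg unfolding ni by (auto simp: interior_translation)
  then have "normal_neg e = - normal_pos e"
    unfolding normal_neg_def normal_pos_def
    using pos disj dim by (intro outward_normal_opposite) (auto simp: face_set_def)
  moreover have "y \<in> pos e" "y - shift e \<in> neg e"
    using y by (auto simp: face_set_def neg_image_def)
  ultimately show ?thesis
    using pos neg by (simp add: jump_def trace_pos_def trace_neg_def elem_trace_one)
qed

section \<open>Jumps across interior and periodic faces\<close>

lemma closure_Omega_x_subset: "closure (Omega_x M) \<subseteq> cbox (\<chi> i. - Lx M) (\<chi> i. Lx M)"
  by (rule closure_minimal) (auto simp: Omega_x_def mem_box_cart less_imp_le)

text \<open>For zero shift the two elements are distinct and the mesh property applies. A nonzero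
  period moves some coordinate by at least \<open>2 * Lx M\<close>, while points of the open cell
  differ by less. This also covers an element adjacent to its own translate.\<close>

lemma interior_neg_image_disjoint:
  assumes wf: "wf_mesh M" and e: "e \<in> adjacent (periods M) (Tx M)"
  shows "interior (pos e) \<inter> interior (neg_image e) = {}"
proof (cases "shift e = 0")
  case True
  then have "neg_image e = neg e" by (simp add: neg_image_def)
  then show ?thesis
    using wf e True by (auto simp: wf_mesh_def adjacent_def mesh_of_def)
next
  case False
  have T: "mesh_of (Tx M) (Omega_x M)" and L: "Lx M > 0"
    using wf by (auto simp: wf_mesh_def)
  have sub: "interior K \<subseteq> box (\<chi> i. - Lx M) (\<chi> i. Lx M)" if "K \<in> Tx M" for K
    using interior_mono[OF order_trans[OF mesh_of_subset[OF T that] closure_Omega_x_subset]]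
    by (simp add: interior_cbox)
  have mem: "pos e \<in> Tx M" "neg e \<in> Tx M" and s: "shift e \<in> periods M"
    using e by (auto simp: adjacent_def)
  obtain i where "shift e $ i \<noteq> 0" using False by (auto simp: vec_eq_iff)
  moreover obtain m :: int where m: "shift e $ i = 2 * Lx M * of_int m"
    using s by (auto simp: periods_def)
  ultimately have "\<bar>real_of_int m\<bar> \<ge> 1" by auto
  then have far: "\<bar>shift e $ i\<bar> \<ge> 2 * Lx M"
    unfolding m using L by (simp add: abs_mult)
  have ni: "neg_image e = (+) (shift e) ` neg e"
    unfolding neg_image_def by (auto simp: add.commute)
  show ?thesis
  proof (rule ccontr)
    assume "\<not> ?thesis"
    then obtain y z where y: "y \<in> interior (pos e)" and z: "z \<in> interior (neg e)"
      and yz: "y = shift e + z"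
      unfolding ni interior_translation by auto
    have "\<bar>y $ i\<bar> < Lx M" "\<bar>z $ i\<bar> < Lx M"
      using sub[OF mem(1)] sub[OF mem(2)] y z by (auto simp: subset_eq mem_box_cart abs_less_iff minus_less_iff)
    then show False using far yz by auto
  qed
qed

lemma jump_x_one:
  assumes "wf_mesh M" "e \<in> Ex M" "y \<in> face_set e"
  shows "jump e (\<lambda>_. 1) y = 0"
proof -
  have "e \<in> adjacent (periods M) (Tx M)" "mesh_of (Tx M) (Omega_x M)"
    using assms by (auto simp: wf_mesh_def face_choice_def)
  then show ?thesis
    using jump_one interior_neg_image_disjoint assms by blast
qed

lemma jump_xi_one:
  assumes "wf_mesh M" "e \<in> Exi M" "y \<in> face_set e"
  shows "jump e (\<lambda>_. 1) y = 0"
proof -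
  have e: "e \<in> adjacent {0} (Txi M)" and T: "mesh_of (Txi M) (Omega_xi M)"
    using assms by (auto simp: wf_mesh_def face_choice_def)
  have "pos e \<in> Txi M" "neg e \<in> Txi M" "pos e \<noteq> neg e" "neg_image e = neg e"
    using e by (auto simp: adjacent_def neg_image_def)
  then have "interior (pos e) \<inter> interior (neg_image e) = {}"
    using T by (simp add: mesh_of_def)
  then show ?thesis
    using jump_one[OF T e] assms by blast
qed

section \<open>The test function \<open>1\<close>\<close>

lemma face_integral_cong:
  "(\<And>y. y \<in> F \<Longrightarrow> h y = h' y) \<Longrightarrow> face_integral F h = face_integral F h'"
  unfolding face_integral_def set_lebesgue_integral_def
  by (rule Bochner_Integration.integral_cong) (auto split: split_indicator)

lemma face_integral_zero:
  "(\<And>y. y \<in> F \<Longrightarrow> h y = 0) \<Longrightarrow> face_integral F h = 0"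
  using face_integral_cong[of F h "\<lambda>_. 0"] by (simp add: face_integral_def)

text \<open>A product determines its factors when they are nonempty. This turns sums over
  \<open>Th M\<close> into double sums.\<close>

lemma Th_bij:
  assumes "\<And>K. K \<in> Tx M \<Longrightarrow> K \<noteq> {}" "\<And>K. K \<in> Txi M \<Longrightarrow> K \<noteq> {}"
  shows "bij_betw (\<lambda>(Kx, Kxi). Kx \<times> Kxi) (Tx M \<times> Txi M) (Th M)"
  unfolding bij_betw_def
proof
  show "inj_on (\<lambda>(Kx, Kxi). Kx \<times> Kxi) (Tx M \<times> Txi M)"
    using assms by (auto intro!: inj_onI simp: times_eq_iff)
qed (auto simp: Th_def)

lemma one_in_Gh: "(\<lambda>_. 1) \<in> Gh M k"
proof -
  \<comment> \<open>Convexity and boundedness make the domain, half-open in \<open>x\<close>, a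
    Lebesgue measurable set of finite measure, so constants are square integrable.\<close>
  have "convex (Omega_x M)" "convex (Omega_xi M)"
    unfolding Omega_x_def Omega_xi_def
    by (intro convex_box_cart is_interval_convex, auto simp: is_interval_1)+
  moreover have "bounded (Omega_x M)" "bounded (Omega_xi M)"
    by (rule bounded_subset[OF bounded_cbox[of "\<chi> i. - Lx M" "\<chi> i. Lx M"]]
        bounded_subset[OF bounded_cbox[of "\<chi> i. - Lxi M" "\<chi> i. Lxi M"]],
        force simp: Omega_x_def Omega_xi_def mem_box_cart less_imp_le)+
  ultimately have "Omega_x M \<times> Omega_xi M \<in> lmeasurable"
    by (intro measurable_convex convex_Times bounded_Times)
  then have "square_integrable (Omega_x M \<times> Omega_xi M) (\<lambda>_. 1)"
    by (auto simp: square_integrable_def set_borel_measurable_def set_integrable_def fmeasurable_def)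
  then show ?thesis
    by (auto simp: Gh_def intro: bexI[OF _ one_in_poly_space])
qed

lemma grad_const: "grad (\<lambda>_. c) x = 0"
  by (simp add: grad_def pd_def zero_vec_def)

text \<open>With \<open>a\<close> the normal component of the acceleration, the average contributes
  \<open>a / 2\<close> and the upwind term \<open>\<bar>a\<bar> / 2\<close>, each times the trace of
  \<open>f\<close>. The point \<open>x\<close> is interior to \<open>Kx\<close>, since there the
  section of \<open>f\<close> is a polynomial section.\<close>

lemma upwind_boundary_flux:
  assumes wf: "wf_mesh M" and f: "f \<in> Gh M k" and KF: "(K, F) \<in> Exi_bd M"
    and Kx: "Kx \<in> Tx M" "x \<in> interior Kx" and \<xi>: "\<xi> \<in> F"
  shows "flux_xi_bd K F f E B x \<xi> \<bullet> jump_bd K F (\<lambda>_. 1) \<xi> =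
    elem_trace K (\<lambda>\<eta>. f (x, \<eta>)) \<xi> * max (accel E B x \<xi> \<bullet> outward_normal K F) 0"
proof -
  have K: "K \<in> Txi M" "F facet_of K" using KF by (auto simp: Exi_bd_def)
  have T: "mesh_of (Txi M) (Omega_xi M)" using wf by (simp add: wf_mesh_def)
  note el = mesh_of_element[OF T K(1)]
  have "\<xi> \<in> K" using K(2) \<xi> facet_of_imp_subset by blast
  have "Kx \<times> K \<in> Th M" using Kx K by (auto simp: Th_def)
  then obtain p where p: "p \<in> poly_space k" and fp: "\<forall>z\<in>interior (Kx \<times> K). f z = p z"
    using f by (auto simp: Gh_def)
  have cont: "continuous_on UNIV (\<lambda>\<eta>. p (x, \<eta>))"
    by (intro continuous_on_compose2[OF poly_space_continuous[OF p]] continuous_intros) auto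
  have fp': "f (x, \<eta>) = p (x, \<eta>)" if "\<eta> \<in> interior K" for \<eta>
    using fp Kx(2) that by (simp add: interior_Times)
  have tr1: "elem_trace K (\<lambda>\<eta>. f (x, \<eta>)) \<xi> = p (x, \<xi>)"
    by (rule elem_trace_eq[where v = "\<lambda>\<eta>. p (x, \<eta>)"]) (use el \<open>\<xi> \<in> K\<close> fp' cont in auto)
  have "continuous_on UNIV (\<lambda>\<eta>. accel E B x \<eta>)"
    unfolding accel_def by (intro continuous_intros continuous_on_cross)
  then have tr2: "elem_trace K (\<lambda>\<eta>. f (x, \<eta>) *\<^sub>R accel E B x \<eta>) \<xi> = p (x, \<xi>) *\<^sub>R accel E B x \<xi>"
    by (intro elem_trace_eq[where v = "\<lambda>\<eta>. p (x, \<eta>) *\<^sub>R accel E B x \<eta>"] continuous_intros)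
      (use el \<open>\<xi> \<in> K\<close> fp' cont in auto)
  have "norm (outward_normal K F) = 1"
    using norm_outward_normal_facet el K by blast
  \<comment> \<open>In the upwind term the jumps of \<open>f\<close> and of 1 each carry the normal,
    so its squared length appears.\<close>
  then have "outward_normal K F \<bullet> outward_normal K F = 1"
    by (simp add: norm_eq_1)
  then show ?thesis
    using el \<open>\<xi> \<in> K\<close>
    by (simp add: flux_xi_bd_def jump_bd_def avg_bd_def tr1 tr2 elem_trace_one
        inner_add_left max_def abs_if algebra_simps)
qed

lemma a_h_one:
  assumes wf: "wf_mesh M" and f: "f t \<in> Gh M k"
  shows "a_h M f E B t (\<lambda>_. 1) = mesh_integral (Th M) (dt f t) + Theta1 M (f t) (E t) (B t)"
proof -
  have T: "mesh_of (Tx M) (Omega_x M)" using wf by (simp add: wf_mesh_def)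
  have x: "face_integral (face_set e) (\<lambda>x. flux_x e (f t) x \<xi> \<bullet> jump e (\<lambda>_. 1) x) = 0"
    if "e \<in> Ex M" for e \<xi>
    using jump_x_one[OF wf that] by (intro face_integral_zero) simp
  have xi: "face_integral (face_set e)
      (\<lambda>\<xi>. flux_xi e (f t) (E t) (B t) x \<xi> \<bullet> jump e (\<lambda>_. 1) \<xi>) = 0" if "e \<in> Exi M" for e x
    using jump_xi_one[OF wf that] by (intro face_integral_zero) simp
  have "mesh_integral (Tx M) (\<lambda>x. \<Sum>(K, F)\<in>Exi_bd M. face_integral F
      (\<lambda>\<xi>. flux_xi_bd K F (f t) (E t) (B t) x \<xi> \<bullet> jump_bd K F (\<lambda>_. 1) \<xi>))
    = Theta1 M (f t) (E t) (B t)"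
    \<comment> \<open>The flux identity is available only for \<open>x\<close> inside an open
      element, which suffices under the integral.\<close>
    unfolding Theta1_def mesh_integral_def
  proof (rule sum.cong[OF refl], rule set_lebesgue_integral_cong_interior)
    fix K assume "K \<in> Tx M"
    then show "convex K" using mesh_of_element[OF T] by blast
    fix x assume "x \<in> interior K"
    with \<open>K \<in> Tx M\<close> show "(\<Sum>(K, F)\<in>Exi_bd M. face_integral F
        (\<lambda>\<xi>. flux_xi_bd K F (f t) (E t) (B t) x \<xi> \<bullet> jump_bd K F (\<lambda>_. 1) \<xi>))
      = (\<Sum>(K, F)\<in>Exi_bd M. face_integral F
       (\<lambda>\<xi>. elem_trace K (\<lambda>\<eta>. f t (x, \<eta>)) \<xi> * max (accel (E t) (B t) x \<xi> \<bullet> outward_normal K F) 0))"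
      by (auto intro!: sum.cong face_integral_cong simp: upwind_boundary_flux[OF wf f])
  qed
  then show ?thesis
    by (simp add: a_h_def grad_const x xi mesh_integral_def split_def)
qed

section \<open>Total mass\<close>

lemma Th_element:
  assumes "wf_mesh M" "K \<in> Th M"
  shows "convex K" "compact K"
  using assms mesh_of_element by (auto simp: Th_def wf_mesh_def intro!: convex_Times compact_Times)

lemma has_real_derivative_mass:
  assumes wf: "wf_mesh M" and sol: "dg_solution M k r flux f E B" and t: "t \<ge> 0"
  shows "((\<lambda>\<tau>. mesh_integral (Th M) (f \<tau>)) has_real_derivative mesh_integral (Th M) (dt f t))
    (at t within {0..})"
  unfolding mesh_integral_def
proof (intro DERIV_sum has_real_derivative_integral_poly_space[where m = k])
  fix K assume K: "K \<in> Th M"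
  show "convex K" "compact K" using Th_element[OF wf K] by auto
  show "\<exists>p\<in>poly_space k. \<forall>z\<in>interior K. f \<tau> z = p z" if "\<tau> \<ge> 0" for \<tau>
    using sol K that by (auto simp: dg_solution_def Gh_def)
  show "(\<lambda>\<tau>. f \<tau> z) differentiable (at t within {0..})" if "z \<in> interior K" for z
    using sol K that t by (auto simp: dg_solution_def)
qed (rule t)

text \<open>Fubini on each product element. It is applied to the continuous polynomial that
  represents \<open>f\<close> there, because the values of \<open>f\<close> on the skeleton are
  arbitrary.\<close>

lemma mesh_integral_rho_h:
  assumes wf: "wf_mesh M" and f: "f \<in> Gh M k"
  shows "mesh_integral (Tx M) (rho_h M f) = mesh_integral (Th M) f"
proof -
  have Tx: "mesh_of (Tx M) (Omega_x M)" and Txi: "mesh_of (Txi M) (Omega_xi M)"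
    using wf by (auto simp: wf_mesh_def)
  have "(LINT x:A|lebesgue. rho_h M f x) = (\<Sum>C\<in>Txi M. LINT z:A\<times>C|lebesgue. f z)"
    if A: "A \<in> Tx M" for A
  proof -
    have "\<forall>C\<in>Txi M. \<exists>p\<in>poly_space k. \<forall>z\<in>interior (A \<times> C). f z = p z"
      using f A by (auto simp: Gh_def Th_def)
    then obtain p where p: "\<And>C. C \<in> Txi M \<Longrightarrow> continuous_on UNIV (p C)"
      and fp: "\<And>C x \<xi>. C \<in> Txi M \<Longrightarrow> x \<in> interior A \<Longrightarrow> \<xi> \<in> interior C \<Longrightarrow> f (x, \<xi>) = p C (x, \<xi>)"
      unfolding interior_Times using poly_space_continuous by (metis mem_Sigma_iff)
    note elA = mesh_of_element[OF Tx A] and elC = mesh_of_element[OF Txi]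
    have "(LINT x:A|lebesgue. rho_h M f x)
        = (LINT x:A|lebesgue. \<Sum>C\<in>Txi M. LINT \<xi>:C|lebesgue. p C (x, \<xi>))"
      unfolding rho_h_def mesh_integral_def using elA elC fp
      by (intro set_lebesgue_integral_cong_interior sum.cong refl) auto
    \<comment> \<open>The finite sum leaves the integral because each section integral is integrable
      over \<open>A\<close>.\<close>
    also have "\<dots> = (\<Sum>C\<in>Txi M. LINT x:A|lebesgue. LINT \<xi>:C|lebesgue. p C (x, \<xi>))"
      using set_integrable_lebesgue_section[OF elA(2) elC(2) p]
      by (simp add: set_lebesgue_integral_def set_integrable_def sum_distrib_left)
    also have "\<dots> = (\<Sum>C\<in>Txi M. LINT z:A\<times>C|lebesgue. p C z)"
      using set_lebesgue_integral_Times[OF elA(2) elC(2) p] by simp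
    also have "\<dots> = (\<Sum>C\<in>Txi M. LINT z:A\<times>C|lebesgue. f z)"
      using elA elC fp
      by (intro sum.cong refl set_lebesgue_integral_cong_interior convex_Times)
        (auto simp: interior_Times)
    finally show ?thesis .
  qed
  then have "mesh_integral (Tx M) (rho_h M f)
      = (\<Sum>A\<in>Tx M. \<Sum>C\<in>Txi M. LINT z:A\<times>C|lebesgue. f z)"
    by (simp add: mesh_integral_def)
  also have "\<dots> = (\<Sum>(A, C)\<in>Tx M \<times> Txi M. LINT z:A\<times>C|lebesgue. f z)"
    by (rule sum.cartesian_product)
  also have "\<dots> = mesh_integral (Th M) f"
    unfolding mesh_integral_def
    using sum.reindex_bij_betw[OF Th_bij, of M "\<lambda>K. LINT z:K|lebesgue. f z"]
      mesh_of_element(3)[OF Tx] mesh_of_element(3)[OF Txi] by (force simp: split_def)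
  finally show ?thesis .
qed

theorem lemma3p1:
  fixes M :: dg_mesh and k r :: nat and flux :: maxwell_flux
    and f :: "real \<Rightarrow> (real^3) \<times> (real^3) \<Rightarrow> real"
    and E B :: "real \<Rightarrow> real^3 \<Rightarrow> real^3"
  assumes "wf_mesh M"
    and "dg_solution M k r flux f E B"
  shows "(\<forall>t\<ge>0. \<exists>D. ((\<lambda>\<tau>. mesh_integral (Th M) (f \<tau>)) has_real_derivative D) (at t within {0..}) \<and>
             D + Theta1 M (f t) (E t) (B t) = 0)
       \<and> (\<forall>T>0. (\<lambda>t. Theta1 M (f t) (E t) (B t)) integrable_on {0..T} \<and>
             mesh_integral (Tx M) (rho_h M (f T))
               + integral {0..T} (\<lambda>t. Theta1 M (f t) (E t) (B t))
             = mesh_integral (Tx M) (rho_h M (f 0)))"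
proof -
  let ?\<Theta> = "\<lambda>t. Theta1 M (f t) (E t) (B t)"
  let ?mass = "\<lambda>t. mesh_integral (Th M) (f t)"
  have Gh: "f t \<in> Gh M k" if "t \<ge> 0" for t
    using assms(2) that by (auto simp: dg_solution_def)
  have "mesh_integral (Th M) (dt f t) = - ?\<Theta> t" if "t \<ge> 0" for t
    using a_h_one[where E=E and B=B and f=f, OF assms(1) Gh[OF that]] assms(2) that one_in_Gh
    by (auto simp: dg_solution_def)
  then have der: "(?mass has_real_derivative - ?\<Theta> t) (at t within {0..})" if "t \<ge> 0" for t
    using has_real_derivative_mass[OF assms that] that by simp
  \<comment> \<open>The fundamental theorem for the gauge integral asks only for the derivative at
    every point, so integrability of \<open>?\<Theta>\<close> comes out as a conclusion.\<close>
  have balance: "((\<lambda>t. - ?\<Theta> t) has_integral (?mass T - ?mass 0)) {0..T}" if "T > 0" for T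
  proof (rule fundamental_theorem_of_calculus)
    fix t assume "t \<in> {0..T}"
    then show "(?mass has_vector_derivative - ?\<Theta> t) (at t within {0..T})"
      using der[of t] has_vector_derivative_within_subset[of ?mass "- ?\<Theta> t" t "{0..}" "{0..T}"]
      by (simp add: has_real_derivative_iff_has_vector_derivative)
  qed (use that in simp)
  show ?thesis
  proof (intro conjI allI impI)
    fix t :: real assume "t \<ge> 0"
    then show "\<exists>D. (?mass has_real_derivative D) (at t within {0..}) \<and> D + ?\<Theta> t = 0"
      using der by (intro exI[of _ "- ?\<Theta> t"]) simp
  next
    fix T :: real assume T: "T > 0"
    have int: "(?\<Theta> has_integral (?mass 0 - ?mass T)) {0..T}"
      using has_integral_neg[OF balance[OF T]] by simp
    then show "?\<Theta> integrable_on {0..T}" by blast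
    show "mesh_integral (Tx M) (rho_h M (f T)) + integral {0..T} ?\<Theta>
        = mesh_integral (Tx M) (rho_h M (f 0))"
      using integral_unique[OF int] mesh_integral_rho_h[OF assms(1) Gh] T by simp
  qed
qed

end
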